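(* Let $(\mathcal{X},\mathcal{F})$ be a measurable space, let $\mathcal{F}_1\subseteq\mathcal{F}$ be a sub-$\sigma$-algebra, let $H$ be a nonempty collection of probability measures on $(\mathcal{X},\mathcal{F})$ dominated by a reference probability measure $\mathbb{R}$ ($\mathbb{P}\ll\mathbb{R}$ for every $\mathbb{P}\in H$), and let $\alpha>0$. Let $(\phi_1^{\mathbb{P}})_{\mathbb{P}\in H}$ be a family of $\mathcal{F}_1$-measurable tests, where each $\phi_1^{\mathbb{P}}$ is valid for $\mathbb{P}$ at level $\alpha$, i.e. $\mathbb{E}^{\mathbb{P}}[\phi_1^{\mathbb{P}}]\le\alpha$. Moreover, let $(\phi_2^{\mathbb{P}})_{\mathbb{P}\in H}$ be a family of $\mathcal{F}$-measurable tests, where each $\phi_2^{\mathbb{P}}$ is conditionally valid for $\mathbb{P}$ at conditional significance level $\phi_1^{\mathbb{P}}$ given $\mathcal{F}_1$, i.e. $\mathbb{E}^{\mathbb{P}}[\phi_2^{\mathbb{P}}\mid\mathcal{F}_1]\le\phi_1^{\mathbb{P}}$ $\mathbb{P}$-almost surely. Then the test $\phi_2^H=\operatorname*{ess\,inf}_{\mathbb{P}\in H}\phi_2^{\mathbb{P}}$ is valid for $H$ at level $\alpha$, i.e. $\sup_{\mathbb{P}\in H}\mathbb{E}^{\mathbb{P}}[\phi_2^H]\le\alpha$.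
   Context: A test is a measurable map from $\mathcal{X}$ to $[0,1]$. For a family $(Y^{\mathbb{P}})_{\mathbb{P}\in H}$ of measurable $[0,1]$-valued functions, $\operatorname*{ess\,inf}_{\mathbb{P}\in H}Y^{\mathbb{P}}$ is the greatest measurable almost-sure lower bound: a measurable $Y$ with $Y\le Y^{\mathbb{P}}$ $\mathbb{R}$-a.s. for every $\mathbb{P}\in H$, and such that any other measurable $Y'$ with this property satisfies $Y'\le Y$ $\mathbb{R}$-a.s. *)

theory Defs
  imports "HOL-Probability.Probability"
begin

definition is_test :: "'a measure \<Rightarrow> ('a \<Rightarrow> real) \<Rightarrow> bool" where
  "is_test M \<phi> \<longleftrightarrow> \<phi> \<in> borel_measurable M \<and> (\<forall>x\<in>space M. \<phi> x \<in> {0..1})"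

text \<open>
  An essential infimum is determined only up to almost sure equality, hence a predicate on
  versions rather than a function. Versions and competing lower bounds are arbitrary real-valued
  measurable functions; they are not required to take values in the unit interval.
\<close>

definition is_ess_inf :: "'a measure \<Rightarrow> 'i set \<Rightarrow> ('i \<Rightarrow> 'a \<Rightarrow> real) \<Rightarrow> ('a \<Rightarrow> real) \<Rightarrow> bool" where
  "is_ess_inf R I Y Z \<longleftrightarrow>
     Z \<in> borel_measurable R \<and> (\<forall>i\<in>I. AE x in R. Z x \<le> Y i x) \<and>
     (\<forall>Z'\<in>borel_measurable R. (\<forall>i\<in>I. AE x in R. Z' x \<le> Y i x) \<longrightarrow> (AE x in R. Z' x \<le> Z x))"

lemma is_ess_inf_unique:
  assumes "is_ess_inf R I Y Z" and "is_ess_inf R I Y Z'"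
  shows "AE x in R. Z x = Z' x"
proof -
  have "AE x in R. Z x \<le> Z' x" "AE x in R. Z' x \<le> Z x"
    using assms unfolding is_ess_inf_def by blast+
  then show ?thesis by eventually_elim auto
qed

lemma is_ess_inf_exists_test:
  assumes "prob_space R" and "I \<noteq> {}" and Y: "\<And>i. i \<in> I \<Longrightarrow> is_test R (Y i)"
  shows "\<exists>Z. is_test R Z \<and> is_ess_inf R I Y Z"
proof -
  interpret prob_space R by fact
  define C where "C = {J. J \<subseteq> I \<and> J \<noteq> {} \<and> countable J}"
  define W where "W J x = (INF i\<in>J. Y i x)" for J x
  have bdd: "bdd_below ((\<lambda>i. Y i x) ` J)" if "J \<in> C" "x \<in> space R" for J x
    using that Y by (intro bdd_belowI2[where m = 0]) (auto simp: C_def is_test_def)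
  have lower: "W J x \<le> Y i x" if "J \<in> C" "x \<in> space R" "i \<in> J" for J x i
    unfolding W_def using bdd that by (intro cINF_lower) auto
  have mono: "W K x \<le> W J x" if "J \<in> C" "K \<in> C" "J \<subseteq> K" "x \<in> space R" for J K x
    unfolding W_def using that bdd by (intro cINF_superset_mono) (auto simp: C_def)
  have test: "is_test R (W J)" if J: "J \<in> C" for J
  proof -
    have "W J \<in> borel_measurable R"
      unfolding W_def using J bdd Y
      by (intro borel_measurable_cINF) (auto simp: C_def is_test_def)
    moreover have "W J x \<in> {0..1}" if x: "x \<in> space R" for x
    proof -
      obtain i where i: "i \<in> J" "i \<in> I" using J by (auto simp: C_def)
      have "W J x \<le> 1" using lower[OF J x i(1)] Y[OF i(2)] x by (force simp: is_test_def)
      moreover have "0 \<le> W J x"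
        unfolding W_def using J Y x by (intro cINF_greatest) (auto simp: C_def is_test_def)
      ultimately show ?thesis by simp
    qed
    ultimately show ?thesis by (auto simp: is_test_def)
  qed
  have int: "integrable R (W J)" if "J \<in> C" for J
    using test[OF that] by (intro integrable_const_bound[where B = 1]) (auto simp: is_test_def)
  define m where "m = (INF J\<in>C. integral\<^sup>L R (W J))"
  have nonneg: "0 \<le> integral\<^sup>L R (W J)" if "J \<in> C" for J
    using test[OF that] by (intro integral_nonneg_AE) (auto simp: is_test_def)
  then have bddm: "bdd_below ((\<lambda>J. integral\<^sup>L R (W J)) ` C)"
    by (intro bdd_belowI2[where m = 0]) auto
  obtain i0 where "i0 \<in> I" using assms by auto
  then have "C \<noteq> {}" by (auto simp: C_def intro!: exI[of _ "{i0}"])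
  then have "\<exists>J\<in>C. integral\<^sup>L R (W J) < m + 1 / Suc n" for n
    using bddm by (subst cINF_less_iff[symmetric]) (auto simp: m_def)
  then obtain J where J: "\<And>n. J n \<in> C" "\<And>n. integral\<^sup>L R (W (J n)) < m + 1 / Suc n"
    by metis
  define K where "K = (\<Union>n. J n)"
  have K: "K \<in> C" using J(1) by (fastforce simp: K_def C_def)
  have "integral\<^sup>L R (W K) \<le> m"
  proof (rule field_le_epsilon)
    fix e :: real assume "0 < e"
    then obtain n where n: "1 / Suc n < e" using nat_approx_posE by metis
    have "integral\<^sup>L R (W K) \<le> integral\<^sup>L R (W (J n))"
      using J(1) K by (intro integral_mono int mono) (auto simp: K_def)
    then show "integral\<^sup>L R (W K) \<le> m + e" using J(2)[of n] n by simp
  qed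
  have le: "AE x in R. W K x \<le> Y i x" if i: "i \<in> I" for i
  proof -
    have L: "insert i K \<in> C" using i K by (auto simp: C_def)
    have "m \<le> integral\<^sup>L R (W (insert i K))"
      unfolding m_def using bddm L by (intro cINF_lower)
    moreover have "integral\<^sup>L R (W (insert i K)) \<le> integral\<^sup>L R (W K)"
      using K L by (intro integral_mono int mono) auto
    ultimately have eq: "integral\<^sup>L R (W K) = integral\<^sup>L R (W (insert i K))"
      using \<open>integral\<^sup>L R (W K) \<le> m\<close> by simp
    have "AE x in R. W K x - W (insert i K) x = 0"
      using K L int mono[OF K L] eq
      by (subst integral_nonneg_eq_0_iff_AE[symmetric]) auto
    moreover have "AE x in R. W (insert i K) x \<le> Y i x"
      using lower[OF L] by auto
    ultimately show ?thesis by eventually_elim auto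
  qed
  have "AE x in R. Z' x \<le> W K x" if "\<forall>i\<in>I. AE x in R. Z' x \<le> Y i x" for Z'
  proof -
    have "AE x in R. \<forall>i\<in>K. Z' x \<le> Y i x"
      using that K by (subst AE_ball_countable) (auto simp: C_def)
    then show ?thesis
    proof eventually_elim
      case (elim x)
      then show ?case
        using K unfolding W_def C_def by (intro cINF_greatest) auto
    qed
  qed
  then have "is_ess_inf R I Y (W K)"
    using le test[OF K] by (auto simp: is_ess_inf_def is_test_def)
  then show ?thesis using test[OF K] by blast
qed

end

theory Submission
  imports Defs
begin

text \<open>
  Each \<open>P \<in> H\<close> is handled separately. The essential infimum lies \<open>R\<close>-almost surely below \<open>\<phi>2 P\<close>,
  and by absolute continuity also \<open>P\<close>-almost surely. So its \<open>P\<close>-expectation is at most that of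
  \<open>\<phi>2 P\<close>. By the tower property the latter is the expectation of the conditional expectation given
  \<open>F1\<close>, which is at most the expectation of \<open>\<phi>1 P\<close>, hence at most \<open>\<alpha>\<close>. This bound does not depend
  on \<open>P\<close>, so it passes to the supremum over the nonempty set \<open>H\<close>.
\<close>

lemma (in prob_space) integrable_test:
  assumes "is_test M \<phi>"
  shows "integrable M \<phi>"
  using assms by (intro integrable_const_bound[where B = 1]) (auto simp: is_test_def)

lemma is_test_mono_algebra:
  assumes "subalgebra M F" and "is_test F \<phi>"
  shows "is_test M \<phi>"
  using assms measurable_from_subalg[OF assms(1)] by (auto simp: is_test_def subalgebra_def)

text \<open>
  The tower property turns conditional validity into unconditional validity: a conditional level
  that is itself a test has its expectation as unconditional level.
\<close>

lemma (in prob_space) integral_le_conditional_level: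
  assumes sub: "subalgebra M F"
    and \<phi>: "is_test F \<phi>" and \<psi>: "is_test M \<psi>"
    and le: "AE x in M. real_cond_exp M F \<psi> x \<le> \<phi> x"
  shows "(\<integral>x. \<psi> x \<partial>M) \<le> (\<integral>x. \<phi> x \<partial>M)"
proof -
  interpret finite_measure_subalgebra M F
    using sub by unfold_locales
  have int\<psi>: "integrable M \<psi>" and int\<phi>: "integrable M \<phi>"
    using \<psi> is_test_mono_algebra[OF sub \<phi>] by (auto intro: integrable_test)
  have "(\<integral>x. \<psi> x \<partial>M) = (\<integral>x. real_cond_exp M F \<psi> x \<partial>M)"
    using real_cond_exp_int(2)[OF int\<psi>] by simp
  also have "\<dots> \<le> (\<integral>x. \<phi> x \<partial>M)"
    using real_cond_exp_int(1)[OF int\<psi>] int\<phi> le by (rule integral_mono_AE)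
  finally show ?thesis .
qed

text \<open>
  Absolute continuity carries the almost sure bound over from \<open>R\<close>. If \<open>Z\<close> is not integrable, its
  integral is 0 by convention, and the inequality then holds because \<open>\<psi>\<close> is nonnegative.
\<close>

lemma (in prob_space) integral_le_of_AE_le_dominating:
  assumes ac: "absolutely_continuous R M" and sets: "sets R = sets M"
    and \<psi>: "is_test M \<psi>" and le: "AE x in R. Z x \<le> \<psi> x"
  shows "(\<integral>x. Z x \<partial>M) \<le> (\<integral>x. \<psi> x \<partial>M)"
proof (rule integral_mono_AE')
  show "integrable M \<psi>" using \<psi> by (rule integrable_test)
  show "AE x in M. Z x \<le> \<psi> x"
    using absolutely_continuous_AE[OF sets[symmetric] ac le] .
  show "AE x in M. 0 \<le> \<psi> x" using \<psi> by (auto simp: is_test_def)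
qed

theorem theorem6:
  fixes M F1 R :: "'a measure"
    and H :: "'a measure set"
    and \<alpha> :: real
    and \<phi>1 \<phi>2 :: "'a measure \<Rightarrow> 'a \<Rightarrow> real"
    and \<phi>2H :: "'a \<Rightarrow> real"
  assumes "subalgebra M F1"
    and "prob_space R" and "sets R = sets M"
    and "H \<noteq> {}"
    and "\<And>P. P \<in> H \<Longrightarrow> prob_space P"
    and "\<And>P. P \<in> H \<Longrightarrow> sets P = sets M"
    and "\<And>P. P \<in> H \<Longrightarrow> absolutely_continuous R P"
    and "\<alpha> > 0"
    and "\<And>P. P \<in> H \<Longrightarrow> is_test F1 (\<phi>1 P)"
    and "\<And>P. P \<in> H \<Longrightarrow> (\<integral>x. \<phi>1 P x \<partial>P) \<le> \<alpha>"
    and "\<And>P. P \<in> H \<Longrightarrow> is_test M (\<phi>2 P)"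
    and "\<And>P. P \<in> H \<Longrightarrow> AE x in P. real_cond_exp P F1 (\<phi>2 P) x \<le> \<phi>1 P x"
    and "is_ess_inf R H \<phi>2 \<phi>2H"
  shows "(SUP P\<in>H. \<integral>x. \<phi>2H x \<partial>P) \<le> \<alpha>"
proof (rule cSUP_least)
  fix P assume P: "P \<in> H"
  interpret prob_space P using assms(5)[OF P] .
  have sP: "sets P = sets M" and space: "space P = space M"
    using assms(6)[OF P] sets_eq_imp_space_eq by auto
  have sub: "subalgebra P F1"
    using assms(1) sP space by (simp add: subalgebra_def)
  have \<phi>2: "is_test P (\<phi>2 P)"
    using assms(11)[OF P] space measurable_cong_sets[OF sP refl] by (auto simp: is_test_def)
  have "(\<integral>x. \<phi>2H x \<partial>P) \<le> (\<integral>x. \<phi>2 P x \<partial>P)"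
    using assms(7)[OF P] _ \<phi>2
  proof (rule integral_le_of_AE_le_dominating)
    show "sets R = sets P" using assms(3) sP by simp
    show "AE x in R. \<phi>2H x \<le> \<phi>2 P x" using assms(13) P by (simp add: is_ess_inf_def)
  qed
  also have "\<dots> \<le> (\<integral>x. \<phi>1 P x \<partial>P)"
    using sub assms(9)[OF P] \<phi>2 assms(12)[OF P] by (rule integral_le_conditional_level)
  also have "\<dots> \<le> \<alpha>" using assms(10)[OF P] .
  finally show "(\<integral>x. \<phi>2H x \<partial>P) \<le> \<alpha>" .
qed (rule assms(4))

end
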